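(* Let $\Phi=\sum_{k=1}^{15}\Phi_k$ and $\Phi^*$ be as in the context. For each of the fifteen 8-form terms $e_{\mu_1\mu_2\cdots\mu_8}$ of $\Phi^*$ ($\mu_1<\dots<\mu_8$), consider the seven pairings of its indices $C_1=\{\mu_1\mu_2,\mu_3\mu_4,\mu_5\mu_6,\mu_7\mu_8\}$, $C_2=\{\mu_1\mu_3,\mu_2\mu_4,\mu_5\mu_7,\mu_6\mu_8\}$, $C_3=\{\mu_1\mu_4,\mu_2\mu_3,\mu_5\mu_8,\mu_6\mu_7\}$, $M_1=\{\mu_1\mu_5,\mu_2\mu_6,\mu_3\mu_7,\mu_4\mu_8\}$, $M_2=\{\mu_1\mu_6,\mu_2\mu_5,\mu_3\mu_8,\mu_4\mu_7\}$, $M_3=\{\mu_1\mu_7,\mu_2\mu_8,\mu_3\mu_5,\mu_4\mu_6\}$, $M_4=\{\mu_1\mu_8,\mu_2\mu_7,\mu_3\mu_6,\mu_4\mu_5\}$. For a pairing $\{a_1b_1,a_2b_2,a_3b_3,a_4b_4\}$ ($a_i<b_i$) and a sign pattern $(\epsilon_1,\epsilon_2,\epsilon_3,\epsilon_4)\in\{(+,+,+,+),(+,+,-,-),(+,-,+,-),(+,-,-,+)\}$, put $$R=\tfrac14(1+\epsilon_1e_{a_1b_1})(1+\epsilon_2e_{a_2b_2})(1+\epsilon_3e_{a_3b_3})(1+\epsilon_4e_{a_4b_4}),$$ a product of four commuting $90^\circ$ rotors in $\mathrm{Spin}(15)$. Then $R\Phi R^{-1}=\sum_{k=1}^{15}\eta_k\Phi_k$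 for some signs $\eta_k\in\{\pm1\}$, i.e. conjugation by $R$ permutes the fifteen 7-form terms of $\Phi$ up to sign. This yields $15\times7=105$ distinct quadruples of rotation planes ("primary invariants"), and $420$ invariants when the four sign patterns are included.
   Context: $Cl_{15}$ denotes the real Clifford algebra generated by $e_1,\dots,e_{15}$, with indices written in hexadecimal ($A=10,\dots,F=15$), subject to $e_i^2=+1$ and $e_ie_j=-e_je_i$ for $i\neq j$. For increasing indices $i_1<\dots<i_k$, $e_{i_1\cdots i_k}=e_{i_1}\cdots e_{i_k}$. The fifteen terms $\Phi_k$ of $\Phi$ are the 7-forms $e_{1234567}$, $e_{12389AB}$, $e_{14589CD}$, $e_{16789EF}$, $e_{2468ACE}$, $e_{2578ADF}$, $e_{3478BCF}$, $e_{3568BDE}$, $e_{123CDEF}$, $e_{145ABEF}$, $e_{167ABCD}$, $e_{2469BDF}$, $e_{2579BCE}$, $e_{3479ADE}$, $e_{3569ACF}$. $\Phi^*=-e_{123456789ABCDEF}\Phi$, whose fifteen terms are the 8-forms $e_{12478BDE}$, $e_{12479ACF}$, $e_{12568BCF}$, $e_{12569ADE}$, $e_{13468ADF}$, $e_{13469BCE}$, $e_{13578ACE}$, $e_{13579BDF}$, $e_{234589EF}$, $e_{2345ABCD}$, $e_{236789CD}$, $e_{2367ABEF}$, $e_{456789AB}$, $e_{4567CDEF}$, $e_{89ABCDEF}$. *)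

theory Defs
  imports Complex_Main
begin

text \<open>The real Clifford algebra Cl_15 with e_i^2 = +1, realised concretely:
  a multivector is a coefficient function on blades (index sets A \<subseteq> {1..15}).
  The basis blade e_A (A increasing) times e_B equals csign A B * e_(A symdiff B),
  where csign counts the transpositions needed to sort the concatenation.\<close>

type_synonym mv = "nat set \<Rightarrow> real"

definition Cl15 :: "mv set" where
  "Cl15 = {x. \<forall>A. x A \<noteq> 0 \<longrightarrow> A \<subseteq> {1..15}}"

definition csign :: "nat set \<Rightarrow> nat set \<Rightarrow> real" where
  "csign A B = (-1) ^ card {(a, b). a \<in> A \<and> b \<in> B \<and> b < a}"

definition clmul :: "mv \<Rightarrow> mv \<Rightarrow> mv" where
  "clmul x y = (\<lambda>C. \<Sum>A\<in>Pow {1..15}. x A * y (A - C \<union> (C - A)) * csign A (A - C \<union> (C - A)))"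

definition blade :: "nat set \<Rightarrow> mv" where
  "blade A = (\<lambda>C. if C = A then 1 else 0)"

definition clone :: mv where "clone = blade {}"

definition scal :: "real \<Rightarrow> mv \<Rightarrow> mv" where
  "scal c x = (\<lambda>C. c * x C)"

definition PhiTerms :: "nat set list" where
  "PhiTerms =
   [{1,2,3,4,5,6,7}, {1,2,3,8,9,10,11}, {1,4,5,8,9,12,13}, {1,6,7,8,9,14,15},
    {2,4,6,8,10,12,14}, {2,5,7,8,10,13,15}, {3,4,7,8,11,12,15}, {3,5,6,8,11,13,14},
    {1,2,3,12,13,14,15}, {1,4,5,10,11,14,15}, {1,6,7,10,11,12,13}, {2,4,6,9,11,13,15},
    {2,5,7,9,11,12,14}, {3,4,7,9,10,13,14}, {3,5,6,9,10,12,15}]"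

definition Phi :: mv where
  "Phi = (\<lambda>C. \<Sum>k<15. blade (PhiTerms ! k) C)"

definition PhiStar :: mv where
  "PhiStar = scal (-1) (clmul (blade {1..15}) Phi)"

text \<open>The seven pairings C1,C2,C3,M1,...,M4, as 0-based positions into the
  increasing index list mu_1 < ... < mu_8 of an 8-form term.\<close>
definition pairings :: "(nat \<times> nat) list list" where
  "pairings =
   [[(0,1),(2,3),(4,5),(6,7)],
    [(0,2),(1,3),(4,6),(5,7)],
    [(0,3),(1,2),(4,7),(5,6)],
    [(0,4),(1,5),(2,6),(3,7)],
    [(0,5),(1,4),(2,7),(3,6)],
    [(0,6),(1,7),(2,4),(3,5)],
    [(0,7),(1,6),(2,5),(3,4)]]"

definition sign_patterns :: "real list list" where
  "sign_patterns = [[1,1,1,1], [1,1,-1,-1], [1,-1,1,-1], [1,-1,-1,1]]"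

definition rot1 :: "nat \<Rightarrow> nat \<Rightarrow> real \<Rightarrow> mv" where
  "rot1 a b eps = (\<lambda>C. if C = {} then 1 else if C = {a, b} then eps else 0)"

definition rotor :: "nat list \<Rightarrow> (nat \<times> nat) list \<Rightarrow> real list \<Rightarrow> mv" where
  "rotor m P s =
     (let f = (\<lambda>i. rot1 (m ! fst (P ! i)) (m ! snd (P ! i)) (s ! i))
      in scal (1/4) (clmul (clmul (clmul (f 0) (f 1)) (f 2)) (f 3)))"

definition planes :: "nat list \<Rightarrow> (nat \<times> nat) list \<Rightarrow> nat set set" where
  "planes m P = (\<lambda>(i, j). {m ! i, m ! j}) ` set P"

end

theory Submission
  imports Defs
begin

text \<open>Conjugation by \<open>1 + \<epsilon> e\<^sub>a\<^sub>b\<close> sends a blade \<open>e\<^sub>T\<close>, up to sign, to the blade of the image of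
  \<open>T\<close> under the transposition of \<open>a\<close> and \<open>b\<close>: the bivector commutes with \<open>e\<^sub>T\<close> if \<open>T\<close> contains both or
  none of \<open>a, b\<close>, and anticommutes otherwise. So it suffices that the product of the four transpositions
  of a pairing permutes the fifteen index sets. For a dual term with index set \<open>A\<close>, every pairing is
  either respected by \<open>T\<close>, and then \<open>T\<close> is fixed, or all four of its pairs are split by \<open>T\<close>, and then \<open>T\<close>
  goes to the symmetric difference of \<open>T\<close> and \<open>A\<close>, which is again one of the fifteen sets because the
  complements of these sets form, together with the empty set, a linear code.

  For the counts, a rotor is recovered from its coefficients: the union of its support is \<open>A\<close>, the
  partner of the least index of \<open>A\<close> determines the pairing, and the coefficients at the four planes are
  a quarter of the signs.\<close>

subsection \<open>Reordering signs\<close>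

text \<open>In this form the inversion count turns into factors that square to 1, which makes
  \<open>csign\<close> multiplicative under symmetric difference.\<close>

lemma csign_eq_prod:
  assumes "finite A" "finite B"
  shows "csign A B = (\<Prod>a\<in>A. \<Prod>b\<in>B. if b < a then -1 else 1)"
proof -
  have "csign A B = (\<Prod>p\<in>{p \<in> A \<times> B. snd p < fst p}. -1)"
    unfolding csign_def prod_constant by (rule arg_cong[where f = "\<lambda>S. (-1) ^ card S"]) auto
  also have "\<dots> = (\<Prod>p\<in>A \<times> B. if snd p < fst p then -1 else 1)"
    using assms by (intro prod.inter_filter) auto
  also have "\<dots> = (\<Prod>a\<in>A. \<Prod>b\<in>B. if b < a then -1 else 1)"
    by (simp add: prod.cartesian_product case_prod_beta)
  finally show ?thesis .
qed

lemma csign_cases: "csign A B = 1 \<or> csign A B = -1"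
  unfolding csign_def by (simp add: minus_one_power_iff)

lemma csign_empty [simp]: "csign {} B = 1" "csign A {} = 1"
  by (simp_all add: csign_def)

text \<open>Common elements occur twice on the right, where they contribute
  \<open>g x * g x = 1\<close>.\<close>

lemma prod_sym_diff:
  fixes g :: "'a \<Rightarrow> 'b::comm_monoid_mult"
  assumes "finite A" "finite B" "\<And>x. g x * g x = 1"
  shows "prod g (sym_diff A B) = prod g A * prod g B"
proof -
  have "prod g A = prod g (A \<inter> B) * prod g (A - B)"
    "prod g B = prod g (A \<inter> B) * prod g (B - A)"
    using assms prod.Int_Diff[of A g B] prod.Int_Diff[of B g A] by (simp_all add: Int_commute)
  then have "prod g A * prod g B
      = (prod g (A \<inter> B) * prod g (A \<inter> B)) * (prod g (A - B) * prod g (B - A))"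
    by (simp only: mult_ac)
  also have "prod g (A \<inter> B) * prod g (A \<inter> B) = 1"
    unfolding prod.distrib[symmetric] using assms(3) by simp
  also have "1 * (prod g (A - B) * prod g (B - A)) = prod g (sym_diff A B)"
    using assms by (subst prod.union_disjoint) auto
  finally show ?thesis by simp
qed

text \<open>Bimultiplicativity of the sign is what makes the Clifford product associative.\<close>

lemma csign_sym_diff_left:
  assumes "finite A" "finite B" "finite C"
  shows "csign (sym_diff A B) C = csign A C * csign B C"
proof -
  have "(\<Prod>b\<in>C. if b < a then -1 else 1) * (\<Prod>b\<in>C. if b < a then -1 else 1) = (1::real)" for a
    unfolding prod.distrib[symmetric] by (rule prod.neutral) simp
  then show ?thesis
    using assms by (simp add: csign_eq_prod prod_sym_diff)
qed

lemma csign_sym_diff_right: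
  assumes "finite A" "finite B" "finite C"
  shows "csign C (sym_diff A B) = csign C A * csign C B"
  using assms by (simp add: csign_eq_prod prod_sym_diff flip: prod.distrib)

text \<open>Each \<open>t \<noteq> a\<close> in \<open>T\<close> forms an inversion with
  \<open>a\<close> in exactly one of the two orders, and \<open>t = a\<close> in neither.\<close>

lemma csign_singleton_commute:
  assumes "finite T"
  shows "csign T {a} * csign {a} T = (-1) ^ card T * (if a \<in> T then -1 else 1)"
proof -
  have "csign T {a} * csign {a} T = (\<Prod>t\<in>T. if t = a then 1 else -1)"
    using assms by (simp add: csign_eq_prod flip: prod.distrib) (intro prod.cong, auto)
  \<comment> \<open>A factor -1 is split off for every element, which leaves a correction only at
    \<open>t = a\<close>.\<close>
  also have "\<dots> = (\<Prod>t\<in>T. -1 * (if t = a then -1 else 1))"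
    by (intro prod.cong) auto
  also have "\<dots> = (-1) ^ card T * (if a \<in> T then -1 else 1)"
    using assms unfolding prod.distrib prod_constant by simp
  finally show ?thesis .
qed

lemma doubleton_eq_sym_diff: "a \<noteq> b \<Longrightarrow> {a, b} = sym_diff {a} {b}"
  by auto

text \<open>The powers \<open>(-1) ^ card T\<close> arising from \<open>a\<close> and from
  \<open>b\<close> cancel, so only the two membership signs remain.\<close>

lemma csign_doubleton_commute:
  assumes "finite T" "a \<noteq> b"
  shows "csign {a, b} T = (if a \<in> T \<longleftrightarrow> b \<in> T then 1 else -1) * csign T {a, b}"
proof -
  have "csign T {a, b} * csign {a, b} T
      = (csign T {a} * csign {a} T) * (csign T {b} * csign {b} T)"
    using csign_sym_diff_left[of "{a}" "{b}" T] csign_sym_diff_right[of "{a}" "{b}" T] assms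
    unfolding doubleton_eq_sym_diff[OF assms(2), symmetric] by (simp add: mult_ac)
  also have "\<dots> = (if a \<in> T \<longleftrightarrow> b \<in> T then 1 else -1)"
    using assms by (simp add: csign_singleton_commute mult_ac flip: power_add)
  finally show ?thesis
    using csign_cases[of T "{a, b}"] by auto
qed

text \<open>Exactly one of the four ordered pairs is an inversion: a unit bivector squares to
  -1.\<close>

lemma csign_doubleton_self: "a \<noteq> b \<Longrightarrow> csign {a, b} {a, b} = -1"
  by (auto simp: csign_eq_prod)

subsection \<open>The Clifford product\<close>

lemma clmul_in_Cl15:
  assumes "y \<in> Cl15"
  shows "clmul x y \<in> Cl15"
  unfolding Cl15_def
proof (intro CollectI allI impI)
  fix C assume "clmul x y C \<noteq> 0"
  then obtain A where "A \<in> Pow {1..15}" "x A * y (sym_diff A C) * csign A (sym_diff A C) \<noteq> 0"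
    unfolding clmul_def by (rule sum.not_neutral_contains_not_neutral)
  then have "A \<subseteq> {1..15}" "sym_diff A C \<subseteq> {1..15}"
    using assms unfolding Cl15_def mult_eq_0_iff by blast+
  then show "C \<subseteq> {1..15}" by blast
qed

text \<open>Both coefficients at \<open>C\<close> sum over blades \<open>B\<close>,
  \<open>D\<close>, \<open>E\<close> of \<open>x\<close>, \<open>y\<close>, \<open>z\<close> with
  total symmetric difference \<open>C\<close>; the signs agree because both equal
  \<open>csign B D * csign B E * csign D E\<close>.\<close>

lemma clmul_assoc:
  assumes z: "z \<in> Cl15"
  shows "clmul (clmul x y) z = clmul x (clmul y z)"
proof
  fix C
  let ?U = "Pow {1..15::nat}"
  have key: "x B * y (sym_diff B A) * csign B (sym_diff B A) * z (sym_diff A C) * csign A (sym_diff A C)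
      = x B * (y (sym_diff B A) * z (sym_diff (sym_diff B A) (sym_diff B C))
          * csign (sym_diff B A) (sym_diff (sym_diff B A) (sym_diff B C))) * csign B (sym_diff B C)"
    if B: "B \<in> ?U" and A: "A \<in> ?U" for A B
  proof -
    define D E F where "D = sym_diff B A" and "E = sym_diff A C" and "F = sym_diff B C"
    have F: "F = sym_diff D E" and E: "sym_diff D F = E" and A': "A = sym_diff B D"
      unfolding D_def E_def F_def by blast+
    have "z E * (csign B D * csign A E) = z E * (csign D E * csign B F)"
    proof (cases "z E = 0")
      case False
      then have "E \<subseteq> {1..15}" using z unfolding Cl15_def by blast
      moreover have "D \<subseteq> {1..15}" using A B unfolding D_def by blast
      ultimately have fin: "finite B" "finite D" "finite E"
        using B by (auto intro: finite_subset)
      show ?thesis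
        unfolding F A' csign_sym_diff_left[OF fin] csign_sym_diff_right[OF fin(2,3,1)] by simp
    qed simp
    then show ?thesis
      unfolding D_def[symmetric] F_def[symmetric] E_def[symmetric] E by (simp add: mult_ac)
  qed
  have "clmul (clmul x y) z C = (\<Sum>A\<in>?U. \<Sum>B\<in>?U. x B * y (sym_diff B A) * csign B (sym_diff B A)
        * z (sym_diff A C) * csign A (sym_diff A C))"
    unfolding clmul_def by (simp add: sum_distrib_right)
  also have "\<dots> = (\<Sum>B\<in>?U. \<Sum>A\<in>?U. x B * y (sym_diff B A) * csign B (sym_diff B A)
        * z (sym_diff A C) * csign A (sym_diff A C))"
    by (rule sum.swap)
  also have "\<dots> = (\<Sum>B\<in>?U. \<Sum>D\<in>?U. x B
        * (y D * z (sym_diff D (sym_diff B C)) * csign D (sym_diff D (sym_diff B C)))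
        * csign B (sym_diff B C))"
  proof (rule sum.cong[OF refl])
    fix B assume B: "B \<in> ?U"
    show "(\<Sum>A\<in>?U. x B * y (sym_diff B A) * csign B (sym_diff B A)
        * z (sym_diff A C) * csign A (sym_diff A C)) = (\<Sum>D\<in>?U. x B
        * (y D * z (sym_diff D (sym_diff B C)) * csign D (sym_diff D (sym_diff B C)))
        * csign B (sym_diff B C))"
    \<comment> \<open>For fixed \<open>B\<close>, the substitution \<open>D = sym_diff B A\<close>
      is an involution of the index range.\<close>
    proof (rule sum.reindex_bij_witness[where i = "sym_diff B" and j = "sym_diff B"], goal_cases)
      case (5 A)
      show ?case using key[OF B 5] by (rule sym)
    qed (use B in blast)+
  qed
  also have "\<dots> = clmul x (clmul y z) C"
    unfolding clmul_def by (simp add: sum_distrib_left sum_distrib_right)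
  finally show "clmul (clmul x y) z C = clmul x (clmul y z) C" .
qed

text \<open>Linearity in the shape \<open>c * x + d * y\<close> suits \<open>rot1_eq\<close>, which
  writes a rotor as a combination of \<open>clone\<close> and one bivector.\<close>

lemma clmul_combine_left:
  "clmul (\<lambda>C. c * x C + d * y C) z = (\<lambda>C. c * clmul x z C + d * clmul y z C)"
  unfolding clmul_def sum_distrib_left sum.distrib[symmetric]
  by (intro ext sum.cong refl) (simp only: algebra_simps)

lemma clmul_combine_right:
  "clmul z (\<lambda>C. c * x C + d * y C) = (\<lambda>C. c * clmul z x C + d * clmul z y C)"
  unfolding clmul_def sum_distrib_left sum.distrib[symmetric]
  by (intro ext sum.cong refl) (simp only: algebra_simps)

lemma clmul_scal_left: "clmul (scal c x) y = scal c (clmul x y)"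
  unfolding clmul_def scal_def sum_distrib_left by (simp only: mult_ac)

lemma clmul_scal_right: "clmul x (scal c y) = scal c (clmul x y)"
  unfolding clmul_def scal_def sum_distrib_left by (simp only: mult_ac)

lemma scal_scal: "scal c (scal d x) = scal (c * d) x"
  by (simp add: scal_def mult.assoc)

lemma scal_one [simp]: "scal 1 x = x"
  by (simp add: scal_def)

lemma clmul_sum_left:
  "clmul (\<lambda>C. \<Sum>k\<in>K. x k C) y = (\<lambda>C. \<Sum>k\<in>K. clmul (x k) y C)"
  unfolding clmul_def by (rule ext, subst sum.swap) (simp add: sum_distrib_right)

lemma clmul_sum_right:
  "clmul x (\<lambda>C. \<Sum>k\<in>K. y k C) = (\<lambda>C. \<Sum>k\<in>K. clmul x (y k) C)"
  unfolding clmul_def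
  by (rule ext, subst sum.swap) (simp add: sum_distrib_left sum_distrib_right)

lemma scal_in_Cl15: "x \<in> Cl15 \<Longrightarrow> scal c x \<in> Cl15"
  by (simp add: Cl15_def scal_def)

lemma blade_in_Cl15: "A \<subseteq> {1..15} \<Longrightarrow> blade A \<in> Cl15"
  by (simp add: Cl15_def blade_def)

lemma blade_clmul_apply:
  assumes "A \<subseteq> {1..15}"
  shows "clmul (blade A) y C = csign A (sym_diff A C) * y (sym_diff A C)"
proof -
  have "clmul (blade A) y C
      = (\<Sum>B\<in>Pow {1..15}. if B = A then csign A (sym_diff A C) * y (sym_diff A C) else 0)"
    unfolding clmul_def blade_def by (intro sum.cong) auto
  then show ?thesis using assms by simp
qed

lemma clmul_blade_apply:
  assumes "x \<in> Cl15" "B \<subseteq> {1..15}"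
  shows "clmul x (blade B) C = csign (sym_diff C B) B * x (sym_diff C B)"
proof -
  have eq: "sym_diff A C = B \<longleftrightarrow> A = sym_diff C B" for A by blast
  have "x A * blade B (sym_diff A C) * csign A (sym_diff A C)
      = (if A = sym_diff C B then csign (sym_diff C B) B * x (sym_diff C B) else 0)" for A
    using eq[of A] by (cases "sym_diff A C = B") (simp_all add: blade_def)
  then have "clmul x (blade B) C = (\<Sum>A\<in>Pow {1..15}. if A = sym_diff C B
      then csign (sym_diff C B) B * x (sym_diff C B) else 0)"
    unfolding clmul_def by simp
  \<comment> \<open>If the only contributing index falls outside the range of summation, the sum is
    zero, and so is the coefficient of \<open>x\<close> there.\<close>
  moreover have "x (sym_diff C B) = 0" if "\<not> sym_diff C B \<subseteq> {1..15}"
    using assms that unfolding Cl15_def by blast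
  ultimately show ?thesis by simp
qed

lemma blade_clmul_blade:
  assumes "A \<subseteq> {1..15}"
  shows "clmul (blade A) (blade B) = scal (csign A B) (blade (sym_diff A B))"
proof
  fix C
  have "sym_diff A C = B \<longleftrightarrow> C = sym_diff A B" by blast
  then show "clmul (blade A) (blade B) C = scal (csign A B) (blade (sym_diff A B)) C"
    unfolding blade_clmul_apply[OF assms] scal_def
    by (cases "sym_diff A C = B") (simp_all add: blade_def)
qed

lemma clmul_clone_left [simp]: "clmul clone x = x"
  unfolding clone_def by (rule ext) (simp add: blade_clmul_apply)

lemma clmul_clone_right [simp]: "x \<in> Cl15 \<Longrightarrow> clmul x clone = x"
  unfolding clone_def by (rule ext) (simp add: clmul_blade_apply)

subsection \<open>Rotors\<close>

text \<open>This is the image of \<open>T\<close> under the transposition \<open>(a b)\<close>,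
  phrased by symmetric difference because that is how blades multiply.\<close>

definition exchange :: "nat \<Rightarrow> nat \<Rightarrow> nat set \<Rightarrow> nat set" where
  "exchange a b T = (if a \<in> T \<longleftrightarrow> b \<in> T then T else sym_diff T {a, b})"

lemma exchange_subset: "T \<subseteq> {1..15} \<Longrightarrow> a \<in> {1..15} \<Longrightarrow> b \<in> {1..15} \<Longrightarrow> exchange a b T \<subseteq> {1..15}"
  by (auto simp: exchange_def)

lemma rot1_eq: "rot1 a b \<epsilon> = (\<lambda>C. 1 * clone C + \<epsilon> * blade {a, b} C)"
  by (auto simp: rot1_def clone_def blade_def)

lemma rot1_in_Cl15: "a \<in> {1..15} \<Longrightarrow> b \<in> {1..15} \<Longrightarrow> rot1 a b \<epsilon> \<in> Cl15"
  by (auto simp: rot1_def Cl15_def)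

text \<open>Since \<open>e_ab\<close> squares to -1, this is complex multiplication with
  \<open>e_ab\<close> as imaginary unit.\<close>

lemma rot1_clmul_rot1:
  assumes "a \<noteq> b" "a \<in> {1..15}" "b \<in> {1..15}"
  shows "clmul (rot1 a b \<epsilon>) (rot1 a b \<delta>)
    = (\<lambda>C. (1 - \<epsilon> * \<delta>) * clone C + (\<epsilon> + \<delta>) * blade {a, b} C)"
proof -
  have "{a, b} \<subseteq> {1..15}" using assms by auto
  then show ?thesis
    unfolding rot1_eq clmul_combine_left clmul_combine_right
    using assms by (simp add: blade_clmul_blade blade_in_Cl15 csign_doubleton_self
        clone_def[symmetric] scal_def algebra_simps)
qed

text \<open>The inverse is kept unnormalised: four such factors 2 give the 16 that the scalars 1/4
  of a rotor and of its inverse cancel.\<close>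

lemma rot1_inverse:
  assumes "a \<noteq> b" "a \<in> {1..15}" "b \<in> {1..15}" "\<epsilon> = 1 \<or> \<epsilon> = -1"
  shows "clmul (rot1 a b \<epsilon>) (rot1 a b (- \<epsilon>)) = scal 2 clone"
  using assms(4) by (auto simp: rot1_clmul_rot1[OF assms(1-3)] scal_def)

lemma rot1_clmul_blade:
  assumes "a \<noteq> b" "a \<in> {1..15}" "b \<in> {1..15}" "T \<subseteq> {1..15}"
  shows "clmul (rot1 a b \<epsilon>) (blade T)
    = clmul (blade T) (rot1 a b (if a \<in> T \<longleftrightarrow> b \<in> T then \<epsilon> else - \<epsilon>))"
proof -
  have "{a, b} \<subseteq> {1..15}" using assms by auto
  moreover have "finite T" using assms by (auto intro: finite_subset)
  moreover have "sym_diff T {a, b} = sym_diff {a, b} T" by blast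
  ultimately show ?thesis
    unfolding rot1_eq clmul_combine_left clmul_combine_right
    using assms by (simp add: blade_clmul_blade blade_in_Cl15 csign_doubleton_commute scal_def)
qed

text \<open>Moving \<open>blade T\<close> to the front leaves
  \<open>(1 + \<epsilon> e_ab)(1 - \<epsilon> e_ab) = 2\<close> if it commutes with
  \<open>e_ab\<close>, and \<open>(1 - \<epsilon> e_ab)^2 = -2 \<epsilon> e_ab\<close> if it
  anticommutes; in the latter case \<open>e_ab\<close> is absorbed into the blade.\<close>

lemma rot1_conj_blade:
  assumes "a \<noteq> b" "a \<in> {1..15}" "b \<in> {1..15}" "T \<subseteq> {1..15}" "\<epsilon> = 1 \<or> \<epsilon> = -1"
  shows "\<exists>c. (c = 1 \<or> c = -1) \<and>
    clmul (rot1 a b \<epsilon>) (clmul (blade T) (rot1 a b (- \<epsilon>))) = scal (2 * c) (blade (exchange a b T))"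
proof -
  let ?r = "rot1 a b" and ?\<epsilon>' = "if a \<in> T \<longleftrightarrow> b \<in> T then \<epsilon> else - \<epsilon>"
  have r: "?r \<delta> \<in> Cl15" for \<delta> using assms by (intro rot1_in_Cl15)
  have "clmul (?r \<epsilon>) (clmul (blade T) (?r (- \<epsilon>))) = clmul (blade T) (clmul (?r ?\<epsilon>') (?r (- \<epsilon>)))"
    using assms by (simp add: rot1_clmul_blade r flip: clmul_assoc)
  moreover have "\<exists>c. (c = 1 \<or> c = -1) \<and> clmul (blade T) (clmul (?r ?\<epsilon>') (?r (- \<epsilon>)))
      = scal (2 * c) (blade (exchange a b T))"
  proof (cases "a \<in> T \<longleftrightarrow> b \<in> T")
    case True
    then show ?thesis
      using assms by (auto simp: rot1_inverse exchange_def clmul_scal_right blade_in_Cl15 intro!: exI[of _ 1])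
  next
    case False
    have "clmul (?r (- \<epsilon>)) (?r (- \<epsilon>)) = scal (- 2 * \<epsilon>) (blade {a, b})"
      using assms(5) by (auto simp: rot1_clmul_rot1[OF assms(1-3)] scal_def)
    with False have "clmul (blade T) (clmul (?r ?\<epsilon>') (?r (- \<epsilon>)))
        = scal (2 * (- \<epsilon> * csign T {a, b})) (blade (exchange a b T))"
      using assms(4) by (simp add: clmul_scal_right blade_clmul_blade scal_scal exchange_def mult.assoc)
    moreover have "- \<epsilon> * csign T {a, b} = 1 \<or> - \<epsilon> * csign T {a, b} = -1"
      using assms(5) csign_cases[of T "{a, b}"] by auto
    ultimately show ?thesis by blast
  qed
  ultimately show ?thesis by simp
qed

text \<open>The trailing factor \<open>X\<close> lets conjugations be carried out from the inside of
  a right-nested product.\<close>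

lemma rot1_conj_blade_clmul:
  assumes "a \<noteq> b" "a \<in> {1..15}" "b \<in> {1..15}" "T \<subseteq> {1..15}" "\<epsilon> = 1 \<or> \<epsilon> = -1" "X \<in> Cl15"
  obtains c where "c = 1 \<or> c = -1"
    "clmul (rot1 a b \<epsilon>) (clmul (blade T) (clmul (rot1 a b (- \<epsilon>)) X))
      = scal (2 * c) (clmul (blade (exchange a b T)) X)"
proof -
  obtain c where c: "c = 1 \<or> c = -1"
    "clmul (rot1 a b \<epsilon>) (clmul (blade T) (rot1 a b (- \<epsilon>))) = scal (2 * c) (blade (exchange a b T))"
    using rot1_conj_blade[OF assms(1-5)] by blast
  have "clmul (rot1 a b \<epsilon>) (clmul (blade T) (clmul (rot1 a b (- \<epsilon>)) X))
      = clmul (clmul (rot1 a b \<epsilon>) (clmul (blade T) (rot1 a b (- \<epsilon>)))) X"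
    using assms by (simp add: clmul_assoc clmul_in_Cl15 rot1_in_Cl15)
  with c that show ?thesis by (simp add: clmul_scal_left)
qed

lemma rot1_inverse_clmul:
  assumes "a \<noteq> b" "a \<in> {1..15}" "b \<in> {1..15}" "\<epsilon> = 1 \<or> \<epsilon> = -1" "X \<in> Cl15"
  shows "clmul (rot1 a b \<epsilon>) (clmul (rot1 a b (- \<epsilon>)) X) = scal 2 X"
  using assms by (simp add: rot1_inverse clmul_scal_left flip: clmul_assoc)

text \<open>The reversed order lets the factors cancel from the inside out, each leaving a 2, and
  2^4 = 16.\<close>

lemma four_rot1_inverse:
  assumes "a0 \<noteq> b0" "a1 \<noteq> b1" "a2 \<noteq> b2" "a3 \<noteq> b3"
    and U: "{a0, b0, a1, b1, a2, b2, a3, b3} \<subseteq> {1..15}"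
    and "d0 = 1 \<or> d0 = -1" "d1 = 1 \<or> d1 = -1" "d2 = 1 \<or> d2 = -1" "d3 = 1 \<or> d3 = -1"
  shows "clmul (clmul (clmul (clmul (rot1 a0 b0 d0) (rot1 a1 b1 d1)) (rot1 a2 b2 d2)) (rot1 a3 b3 d3))
      (clmul (clmul (clmul (rot1 a3 b3 (- d3)) (rot1 a2 b2 (- d2))) (rot1 a1 b1 (- d1))) (rot1 a0 b0 (- d0)))
    = scal 16 clone"
  using assms by (simp add: clmul_assoc clmul_in_Cl15 rot1_in_Cl15 rot1_inverse_clmul rot1_inverse
      clmul_scal_right scal_scal)

lemma four_rot1_conj_blade:
  assumes "a0 \<noteq> b0" "a1 \<noteq> b1" "a2 \<noteq> b2" "a3 \<noteq> b3"
    and U: "{a0, b0, a1, b1, a2, b2, a3, b3} \<subseteq> {1..15}" and T: "T \<subseteq> {1..15}"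
    and "d0 = 1 \<or> d0 = -1" "d1 = 1 \<or> d1 = -1" "d2 = 1 \<or> d2 = -1" "d3 = 1 \<or> d3 = -1"
  shows "\<exists>c. (c = 1 \<or> c = -1) \<and>
    clmul (clmul (clmul (clmul (clmul (rot1 a0 b0 d0) (rot1 a1 b1 d1)) (rot1 a2 b2 d2)) (rot1 a3 b3 d3))
      (blade T))
      (clmul (clmul (clmul (rot1 a3 b3 (- d3)) (rot1 a2 b2 (- d2))) (rot1 a1 b1 (- d1))) (rot1 a0 b0 (- d0)))
    = scal (16 * c) (blade (exchange a0 b0 (exchange a1 b1 (exchange a2 b2 (exchange a3 b3 T)))))"
proof -
  have r: "rot1 a0 b0 \<delta> \<in> Cl15" "rot1 a1 b1 \<delta> \<in> Cl15" "rot1 a2 b2 \<delta> \<in> Cl15" "rot1 a3 b3 \<delta> \<in> Cl15" for \<delta>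
    using U by (auto intro!: rot1_in_Cl15)
  \<comment> \<open>The conjugation nearest the blade acts first, so the index set passes through
    \<open>T\<close>, \<open>T3\<close>, \<open>T2\<close>, \<open>T1\<close>.\<close>
  define T3 T2 T1 where "T3 = exchange a3 b3 T" and "T2 = exchange a2 b2 T3" and "T1 = exchange a1 b1 T2"
  have T': "T3 \<subseteq> {1..15}" "T2 \<subseteq> {1..15}" "T1 \<subseteq> {1..15}"
    using U T unfolding T1_def T2_def T3_def by ((intro exchange_subset; simp)+)
  \<comment> \<open>What remains on the right after the inner conjugations: \<open>?X3\<close>, then
    \<open>?X2\<close>, then \<open>?X1\<close>.\<close>
  let ?X1 = "rot1 a0 b0 (- d0)" let ?X2 = "clmul (rot1 a1 b1 (- d1)) ?X1"
  let ?X3 = "clmul (rot1 a2 b2 (- d2)) ?X2"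
  have X: "?X1 \<in> Cl15" "?X2 \<in> Cl15" "?X3 \<in> Cl15" by (simp_all add: clmul_in_Cl15 r)
  obtain c3 where c3: "c3 = 1 \<or> c3 = -1"
    "clmul (rot1 a3 b3 d3) (clmul (blade T) (clmul (rot1 a3 b3 (- d3)) ?X3))
      = scal (2 * c3) (clmul (blade T3) ?X3)"
    using rot1_conj_blade_clmul[of a3 b3 T d3 ?X3] assms X unfolding T3_def by auto
  obtain c2 where c2: "c2 = 1 \<or> c2 = -1"
    "clmul (rot1 a2 b2 d2) (clmul (blade T3) ?X3) = scal (2 * c2) (clmul (blade T2) ?X2)"
    using rot1_conj_blade_clmul[of a2 b2 T3 d2 ?X2] assms X T' unfolding T2_def by auto
  obtain c1 where c1: "c1 = 1 \<or> c1 = -1"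
    "clmul (rot1 a1 b1 d1) (clmul (blade T2) ?X2) = scal (2 * c1) (clmul (blade T1) ?X1)"
    using rot1_conj_blade_clmul[of a1 b1 T2 d1 ?X1] assms X T' unfolding T1_def by auto
  obtain c0 where c0: "c0 = 1 \<or> c0 = -1"
    "clmul (rot1 a0 b0 d0) (clmul (blade T1) ?X1) = scal (2 * c0) (blade (exchange a0 b0 T1))"
    using rot1_conj_blade[of a0 b0 T1 d0] assms X T' by auto
  have "clmul (clmul (clmul (clmul (clmul (rot1 a0 b0 d0) (rot1 a1 b1 d1)) (rot1 a2 b2 d2)) (rot1 a3 b3 d3))
      (blade T))
      (clmul (clmul (clmul (rot1 a3 b3 (- d3)) (rot1 a2 b2 (- d2))) (rot1 a1 b1 (- d1))) (rot1 a0 b0 (- d0)))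
    = scal (16 * (c0 * c1 * c2 * c3)) (blade (exchange a0 b0 T1))"
    by (simp add: clmul_assoc r X clmul_in_Cl15 blade_in_Cl15 T c0 c1 c2 c3 clmul_scal_right scal_scal mult_ac)
  moreover have "c0 * c1 * c2 * c3 = 1 \<or> c0 * c1 * c2 * c3 = -1"
    using c0(1) c1(1) c2(1) c3(1) by auto
  ultimately show ?thesis unfolding T1_def T2_def T3_def by blast
qed

section \<open>Coefficients of a product of rotors in disjoint planes\<close>

lemma clmul_rot1_fresh:
  assumes x: "x \<in> Cl15" "\<forall>C. x C \<noteq> 0 \<longrightarrow> C \<subseteq> W" and ab: "a \<notin> W" "b \<notin> W" "a \<in> {1..15}" "b \<in> {1..15}"
  shows "clmul x (rot1 a b \<epsilon>) C =
    (if a \<in> C \<and> b \<in> C then \<epsilon> * csign (C - {a, b}) {a, b} * x (C - {a, b})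
     else if a \<in> C \<or> b \<in> C then 0 else x C)"
proof -
  have "{a, b} \<subseteq> {1..15}" using ab by auto
  then have *: "clmul x (rot1 a b \<epsilon>) C
      = x C + \<epsilon> * (csign (sym_diff C {a, b}) {a, b} * x (sym_diff C {a, b}))"
    unfolding rot1_eq clmul_combine_right using x by (simp add: clmul_blade_apply)
  \<comment> \<open>Since \<open>a\<close> and \<open>b\<close> are new, the summands
    \<open>x\<close> and \<open>\<epsilon> x e_ab\<close> have disjoint supports: no coefficient
    mixes the two.\<close>
  have out: "x D = 0" if "a \<in> D \<or> b \<in> D" for D
    using that x(2) ab by blast
  consider "a \<in> C" "b \<in> C" | "a \<in> C" "b \<notin> C" | "a \<notin> C" "b \<in> C" | "a \<notin> C" "b \<notin> C" by blast
  then show ?thesis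
  proof cases
    case 1
    then have "sym_diff C {a, b} = C - {a, b}" by blast
    then show ?thesis using * out[of C] 1 by simp
  next
    case 2
    then show ?thesis using * out[of C] out[of "sym_diff C {a, b}"] by simp
  next
    case 3
    then show ?thesis using * out[of C] out[of "sym_diff C {a, b}"] by simp
  next
    case 4
    then show ?thesis using * out[of "sym_diff C {a, b}"] by simp
  qed
qed

lemma clmul_rot1_fresh_support:
  assumes "x \<in> Cl15" "\<forall>C. x C \<noteq> 0 \<longrightarrow> C \<subseteq> W" and "a \<notin> W" "b \<notin> W" "a \<in> {1..15}" "b \<in> {1..15}"
    and "clmul x (rot1 a b \<epsilon>) C \<noteq> 0"
  shows "C \<subseteq> W \<union> {a, b}" "a \<in> C \<longleftrightarrow> b \<in> C" "x (C - {a, b}) \<noteq> 0"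
proof -
  note * = assms(7)[unfolded clmul_rot1_fresh[OF assms(1-6)]]
  then show iff: "a \<in> C \<longleftrightarrow> b \<in> C" by (auto split: if_splits)
  have "a \<notin> C \<Longrightarrow> b \<notin> C \<Longrightarrow> C - {a, b} = C" by blast
  with * iff show **: "x (C - {a, b}) \<noteq> 0" by (auto split: if_splits)
  show "C \<subseteq> W \<union> {a, b}" using assms(2) ** by blast
qed

text \<open>The coefficient at a plane comes from taking the bivector in that factor and 1 in the
  others, so no reordering sign enters. The two support facts serve to read the index set and the
  partner of \<open>a0\<close> off a rotor.\<close>

lemma four_rot1_coeff:
  fixes d0 d1 d2 d3 :: real
  assumes dist: "distinct [a0, b0, a1, b1, a2, b2, a3, b3]"
    and U: "{a0, b0, a1, b1, a2, b2, a3, b3} \<subseteq> {1..15}"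
  defines "Q \<equiv> clmul (clmul (clmul (rot1 a0 b0 d0) (rot1 a1 b1 d1)) (rot1 a2 b2 d2)) (rot1 a3 b3 d3)"
  shows "Q {a0, b0} = d0" "Q {a1, b1} = d1" "Q {a2, b2} = d2" "Q {a3, b3} = d3"
    and "Q C \<noteq> 0 \<Longrightarrow> C \<subseteq> {a0, b0, a1, b1, a2, b2, a3, b3}"
    and "Q C \<noteq> 0 \<Longrightarrow> a0 \<in> C \<longleftrightarrow> b0 \<in> C"
proof -
  define x0 x1 x2 where "x0 = rot1 a0 b0 d0" and "x1 = clmul x0 (rot1 a1 b1 d1)"
    and "x2 = clmul x1 (rot1 a2 b2 d2)"
  have Q: "Q = clmul x2 (rot1 a3 b3 d3)"
    unfolding Q_def x2_def x1_def x0_def ..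
  have r: "rot1 a0 b0 d0 \<in> Cl15" "rot1 a1 b1 d1 \<in> Cl15" "rot1 a2 b2 d2 \<in> Cl15"
    using U by (auto intro!: rot1_in_Cl15)
  then have Cl: "x0 \<in> Cl15" "x1 \<in> Cl15" "x2 \<in> Cl15"
    by (simp_all add: x0_def x1_def x2_def clmul_in_Cl15)
  have s0: "C \<subseteq> {a0, b0}" "a0 \<in> C \<longleftrightarrow> b0 \<in> C" if "x0 C \<noteq> 0" for C
    using that by (auto simp: x0_def rot1_def split: if_splits)
  have f1: "a1 \<notin> {a0, b0}" "b1 \<notin> {a0, b0}" "a1 \<in> {1..15}" "b1 \<in> {1..15}"
    and f2: "a2 \<notin> {a0, b0} \<union> {a1, b1}" "b2 \<notin> {a0, b0} \<union> {a1, b1}" "a2 \<in> {1..15}" "b2 \<in> {1..15}"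
    and f3: "a3 \<notin> {a0, b0} \<union> {a1, b1} \<union> {a2, b2}" "b3 \<notin> {a0, b0} \<union> {a1, b1} \<union> {a2, b2}"
      "a3 \<in> {1..15}" "b3 \<in> {1..15}"
    using dist U by auto
  have w0: "\<forall>C. x0 C \<noteq> 0 \<longrightarrow> C \<subseteq> {a0, b0}" using s0 by blast
  note n1 = clmul_rot1_fresh_support[OF Cl(1) w0 f1, of d1, folded x1_def]
  have w1: "\<forall>C. x1 C \<noteq> 0 \<longrightarrow> C \<subseteq> {a0, b0} \<union> {a1, b1}" using n1(1) by blast
  note n2 = clmul_rot1_fresh_support[OF Cl(2) w1 f2, of d2, folded x2_def]
  have w2: "\<forall>C. x2 C \<noteq> 0 \<longrightarrow> C \<subseteq> {a0, b0} \<union> {a1, b1} \<union> {a2, b2}" using n2(1) by blast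
  note n3 = clmul_rot1_fresh_support[OF Cl(3) w2 f3, of d3, folded Q]
  note e1 = clmul_rot1_fresh[OF Cl(1) w0 f1, of d1, folded x1_def]
  note e2 = clmul_rot1_fresh[OF Cl(2) w1 f2, of d2, folded x2_def]
  note e3 = clmul_rot1_fresh[OF Cl(3) w2 f3, of d3, folded Q]
  have x0: "x0 {a0, b0} = d0" "x0 {} = 1" by (simp_all add: x0_def rot1_def)
  show "Q {a0, b0} = d0" "Q {a1, b1} = d1" "Q {a2, b2} = d2" "Q {a3, b3} = d3"
    using dist by (auto simp: e1 e2 e3 x0)
  show "C \<subseteq> {a0, b0, a1, b1, a2, b2, a3, b3}" if "Q C \<noteq> 0"
    using n3(1)[OF that] by auto
  show "a0 \<in> C \<longleftrightarrow> b0 \<in> C" if "Q C \<noteq> 0"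
    \<comment> \<open>Removing the later pairs one by one leads from the support of \<open>Q\<close>
      down to that of \<open>x0\<close>, without touching \<open>a0\<close> and
      \<open>b0\<close>.\<close>
    using s0(2)[OF n1(3)[OF n2(3)[OF n3(3)[OF that]]]] dist by auto
qed

subsection \<open>The terms of Phi and their duals\<close>

text \<open>Increasing lists make \<open>m ! i\<close> the index \<mu> with number
  \<open>i + 1\<close> and keep the combinatorial checks executable.
  \<open>PhiStar_nonzero_iff\<close> shows that these are the terms of
  \<open>PhiStar\<close>.\<close>

definition dual_lists :: "nat list list" where
  "dual_lists =
   [[1,2,4,7,8,11,13,14], [1,2,4,7,9,10,12,15], [1,2,5,6,8,11,12,15], [1,2,5,6,9,10,13,14],
    [1,3,4,6,8,10,13,15], [1,3,4,6,9,11,12,14], [1,3,5,7,8,10,12,14], [1,3,5,7,9,11,13,15],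
    [2,3,4,5,8,9,14,15], [2,3,4,5,10,11,12,13], [2,3,6,7,8,9,12,13], [2,3,6,7,10,11,14,15],
    [4,5,6,7,8,9,10,11], [4,5,6,7,12,13,14,15], [8,9,10,11,12,13,14,15]]"

text \<open>The product with the pseudoscalar complements index sets, here as symmetric difference
  with \<open>{1..15}\<close>.\<close>

lemma set_dual_lists: "set ` set dual_lists = sym_diff {1..15} ` set PhiTerms"
  by code_simp

text \<open>This is closure of the code of complements under addition: with
  \<open>A = set m\<close>, the complement of \<open>sym_diff T A\<close> is the sum of
  \<open>A\<close> and the complement of \<open>T\<close>. The sum is zero exactly when these two
  coincide, that is when \<open>T\<close> misses \<open>A\<close>, both having eight
  elements.\<close>

lemma PhiTerms_sym_diff_dual:
  "\<forall>m\<in>set dual_lists. \<forall>T\<in>set PhiTerms. T \<inter> set m = {} \<or> sym_diff T (set m) \<in> set PhiTerms"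
  by code_simp

text \<open>Reading the positions 0..7 in a dual term in binary as points of AG(3,2), the seven pairings
  are its seven nonzero translations, and a term of Phi meets the dual term in an affine plane or not
  at all. A translation maps a plane to itself or to its complement.\<close>

lemma pairing_respects_or_splits:
  "\<forall>m\<in>set dual_lists. \<forall>P\<in>set pairings. \<forall>T\<in>set PhiTerms.
    (\<forall>(i, j)\<in>set P. m ! i \<in> T \<longleftrightarrow> m ! j \<in> T) \<or> (\<forall>(i, j)\<in>set P. m ! i \<in> T \<longleftrightarrow> m ! j \<notin> T)"
  by code_simp

lemma distinct_PhiTerms: "distinct PhiTerms"
  by code_simp

lemma PhiTerms_subset: "T \<in> set PhiTerms \<Longrightarrow> T \<subseteq> {1..15}"
  by (auto simp: PhiTerms_def)

lemma length_PhiTerms: "length PhiTerms = 15"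
  by (simp add: PhiTerms_def)

lemma dual_list_props:
  assumes "m \<in> set dual_lists"
  shows "sorted m" "distinct m" "length m = 8" "set m \<subseteq> {1..15}"
  using assms by (auto simp: dual_lists_def)

lemma sorted_list_of_dual_list: "m \<in> set dual_lists \<Longrightarrow> sorted_list_of_set (set m) = m"
  by (simp add: dual_list_props sorted_list_of_set.idem_if_sorted_distinct)

lemma card_dual_lists: "card (set dual_lists) = 15"
  by (simp add: dual_lists_def)

lemma card_pairings: "card (set pairings) = 7"
  by (simp add: pairings_def)

lemma card_sign_patterns: "card (set sign_patterns) = 4"
  by (simp add: sign_patterns_def)

text \<open>These facts let one argument serve all seven pairings and make position 0 the place
  where a pairing is recognised.\<close>

lemma pairing_indices:
  "\<forall>P\<in>set pairings. length P = 4 \<and> fst (P ! 0) = 0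
    \<and> distinct (concat (map (\<lambda>(i, j). [i, j]) P)) \<and> set (concat (map (\<lambda>(i, j). [i, j]) P)) = {0..<8}"
  by code_simp

lemma pairing_ordered: "P \<in> set pairings \<Longrightarrow> (i, j) \<in> set P \<Longrightarrow> i < j"
  by (auto simp: pairings_def)

text \<open>The seven pairings give position 0 its seven possible partners, each once.\<close>

lemma pairing_eqI: "P \<in> set pairings \<Longrightarrow> Q \<in> set pairings \<Longrightarrow> P ! 0 \<in> set Q \<Longrightarrow> P = Q"
  by (auto simp: pairings_def)

lemma sign_pattern_props:
  assumes "s \<in> set sign_patterns"
  shows "length s = 4" "s ! 0 = 1 \<or> s ! 0 = -1" "s ! 1 = 1 \<or> s ! 1 = -1"
    "s ! 2 = 1 \<or> s ! 2 = -1" "s ! 3 = 1 \<or> s ! 3 = -1"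
  using assms by (auto simp: sign_patterns_def)

lemma pairing_nth:
  assumes P: "P \<in> set pairings" and m: "distinct m" "length m = 8"
  obtains j0 i1 j1 i2 j2 i3 j3 where "P = [(0, j0), (i1, j1), (i2, j2), (i3, j3)]" "j0 < 8"
    "distinct [m ! 0, m ! j0, m ! i1, m ! j1, m ! i2, m ! j2, m ! i3, m ! j3]"
    "{m ! 0, m ! j0, m ! i1, m ! j1, m ! i2, m ! j2, m ! i3, m ! j3} = set m"
proof -
  let ?L = "concat (map (\<lambda>(i, j). [i, j]) P)"
  have "length P = 4" and fst0: "fst (P ! 0) = 0" and L: "distinct ?L" "set ?L = {0..<8}"
    using P pairing_indices by blast+
  then obtain p0 p1 p2 p3 where Peq: "P = [p0, p1, p2, p3]"
    by (auto simp: numeral_eq_Suc length_Suc_conv)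
  obtain j0 i1 j1 i2 j2 i3 j3 where
    P': "P = [(0, j0), (i1, j1), (i2, j2), (i3, j3)]"
    using fst0 unfolding Peq by (cases p0; cases p1; cases p2; cases p3) auto
  \<comment> \<open>Distinct positions carry distinct indices, so the partition of the positions
    becomes one of the term.\<close>
  have "inj_on ((!) m) (set ?L)"
    unfolding L(2) using m by (intro inj_on_nth) auto
  then have d: "distinct (map ((!) m) ?L)"
    using L(1) by (simp only: distinct_map)
  have s: "set (map ((!) m) ?L) = set m"
    unfolding set_map L(2) using m(2) by (metis nth_image order_refl take_all)
  have "j0 \<in> set ?L" by (simp add: P')
  then have "j0 < 8" unfolding L(2) by simp
  then show thesis
    using that[OF P'] d s by (simp add: P')
qed

text \<open>The coefficient at \<open>A\<close> is, up to sign, the coefficient of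
  \<open>Phi\<close> at the complement.\<close>

lemma PhiStar_nonzero_iff: "PhiStar A \<noteq> 0 \<longleftrightarrow> A \<in> set ` set dual_lists"
proof -
  \<comment> \<open>The symmetric difference is undone by itself for every \<open>A\<close>,
    including sets outside \<open>{1..15}\<close>.\<close>
  define B where "B = sym_diff {1..15} A"
  have "PhiStar A = - (csign {1..15} B * Phi B)"
    unfolding PhiStar_def scal_def by (simp add: blade_clmul_apply B_def)
  then have "PhiStar A \<noteq> 0 \<longleftrightarrow> Phi B \<noteq> 0"
    using csign_cases[of "{1..15}" B] by auto
  \<comment> \<open>All summands are 0 or 1, so terms cannot cancel.\<close>
  also have "\<dots> \<longleftrightarrow> (\<exists>k<15. blade (PhiTerms ! k) B \<noteq> 0)"
    unfolding Phi_def by (subst sum_nonneg_eq_0_iff) (auto simp: blade_def)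
  also have "\<dots> \<longleftrightarrow> B \<in> set PhiTerms"
    by (auto simp: blade_def in_set_conv_nth length_PhiTerms)
  also have "\<dots> \<longleftrightarrow> A \<in> sym_diff {1..15} ` set PhiTerms"
  proof
    have "A = sym_diff {1..15} B" unfolding B_def by blast
    then show "B \<in> set PhiTerms \<Longrightarrow> A \<in> sym_diff {1..15} ` set PhiTerms" by (rule image_eqI)
  next
    assume "A \<in> sym_diff {1..15} ` set PhiTerms"
    then obtain T where "T \<in> set PhiTerms" "A = sym_diff {1..15} T" by (rule imageE)
    moreover from this(2) have "B = T" unfolding B_def by blast
    ultimately show "B \<in> set PhiTerms" by simp
  qed
  finally show ?thesis unfolding set_dual_lists .
qed

section \<open>Action of the rotors on the terms of \<open>Phi\<close>\<close>

lemma sum_PhiTerms_nth: "(\<Sum>k<15. f (PhiTerms ! k)) = (\<Sum>T\<in>set PhiTerms. f T)"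
  by (rule sum.reindex_bij_betw, rule bij_betw_nth) (simp_all add: distinct_PhiTerms length_PhiTerms)

lemma exchange_split: "a \<in> T \<longleftrightarrow> b \<notin> T \<Longrightarrow> exchange a b T = sym_diff T {a, b}"
  by (auto simp: exchange_def)

lemma exchange_same: "a \<in> T \<longleftrightarrow> b \<in> T \<Longrightarrow> exchange a b T = T"
  by (auto simp: exchange_def)

text \<open>The pairs are disjoint, so an exchange leaves the other pairs split.\<close>

lemma four_exchange_split:
  assumes "distinct [a0, b0, a1, b1, a2, b2, a3, b3]"
    and "a0 \<in> T \<longleftrightarrow> b0 \<notin> T" "a1 \<in> T \<longleftrightarrow> b1 \<notin> T" "a2 \<in> T \<longleftrightarrow> b2 \<notin> T" "a3 \<in> T \<longleftrightarrow> b3 \<notin> T"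
  shows "exchange a0 b0 (exchange a1 b1 (exchange a2 b2 (exchange a3 b3 T))) = sym_diff T {a0, b0, a1, b1, a2, b2, a3, b3}"
proof -
  \<comment> \<open>\<open>X\<close> collects the elements of the pairs already exchanged.\<close>
  have step: "exchange a b (sym_diff T X) = sym_diff T (X \<union> {a, b})"
    if "a \<notin> X" "b \<notin> X" "a \<in> T \<longleftrightarrow> b \<notin> T" for a b X
  proof -
    have "exchange a b (sym_diff T X) = sym_diff (sym_diff T X) {a, b}"
      using that by (intro exchange_split) blast
    also have "\<dots> = sym_diff T (X \<union> {a, b})" using that by blast
    finally show ?thesis .
  qed
  have "exchange a3 b3 T = sym_diff T {a3, b3}"
    using assms by (intro exchange_split)
  moreover have "exchange a2 b2 (sym_diff T {a3, b3}) = sym_diff T ({a3, b3} \<union> {a2, b2})"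
    using assms by (intro step) simp_all
  moreover have "exchange a1 b1 (sym_diff T ({a3, b3} \<union> {a2, b2})) = sym_diff T ({a3, b3} \<union> {a2, b2} \<union> {a1, b1})"
    using assms by (intro step) simp_all
  moreover have "exchange a0 b0 (sym_diff T ({a3, b3} \<union> {a2, b2} \<union> {a1, b1}))
      = sym_diff T ({a3, b3} \<union> {a2, b2} \<union> {a1, b1} \<union> {a0, b0})"
    using assms by (intro step) simp_all
  moreover have "{a3, b3} \<union> {a2, b2} \<union> {a1, b1} \<union> {a0, b0} = {a0, b0, a1, b1, a2, b2, a3, b3}"
    by blast
  ultimately show ?thesis by (simp only:)
qed

lemma rotor_conj_Phi:
  assumes m: "m \<in> set dual_lists" and P: "P \<in> set pairings" and s: "s \<in> set sign_patterns"
  shows "\<exists>S\<in>Cl15. clmul (rotor m P s) S = clone \<and> clmul S (rotor m P s) = clone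
    \<and> (\<exists>\<eta>::nat \<Rightarrow> real. (\<forall>k<15. \<eta> k = 1 \<or> \<eta> k = -1)
      \<and> clmul (clmul (rotor m P s) Phi) S = (\<lambda>C. \<Sum>k<15. \<eta> k * blade (PhiTerms ! k) C))"
proof -
  note mp = dual_list_props[OF m] and sp = sign_pattern_props[OF s]
  obtain j0 i1 j1 i2 j2 i3 j3 where P': "P = [(0, j0), (i1, j1), (i2, j2), (i3, j3)]"
    and dist: "distinct [m ! 0, m ! j0, m ! i1, m ! j1, m ! i2, m ! j2, m ! i3, m ! j3]"
    and set_m: "{m ! 0, m ! j0, m ! i1, m ! j1, m ! i2, m ! j2, m ! i3, m ! j3} = set m"
    using pairing_nth[OF P mp(2,3)] by metis
  define Q where "Q = clmul (clmul (clmul (rot1 (m ! 0) (m ! j0) (s ! 0)) (rot1 (m ! i1) (m ! j1) (s ! 1)))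
      (rot1 (m ! i2) (m ! j2) (s ! 2))) (rot1 (m ! i3) (m ! j3) (s ! 3))"
  \<comment> \<open>The reverse of \<open>Q\<close>: factors in opposite order, bivectors
    negated.\<close>
  define Q' where "Q' = clmul (clmul (clmul (rot1 (m ! i3) (m ! j3) (- s ! 3)) (rot1 (m ! i2) (m ! j2) (- s ! 2)))
      (rot1 (m ! i1) (m ! j1) (- s ! 1))) (rot1 (m ! 0) (m ! j0) (- s ! 0))"
  define S where "S = scal (1/4) Q'"
  have R: "rotor m P s = scal (1/4) Q"
    by (simp add: rotor_def P' Q_def)
  have U: "{m ! 0, m ! j0, m ! i1, m ! j1, m ! i2, m ! j2, m ! i3, m ! j3} \<subseteq> {1..15}"
    using set_m mp(4) by simp
  have U': "{m ! i3, m ! j3, m ! i2, m ! j2, m ! i1, m ! j1, m ! 0, m ! j0} \<subseteq> {1..15}"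
    using U by blast
  have ne: "m ! 0 \<noteq> m ! j0" "m ! i1 \<noteq> m ! j1" "m ! i2 \<noteq> m ! j2" "m ! i3 \<noteq> m ! j3"
    using dist by auto
  have sm: "- s ! 0 = 1 \<or> - s ! 0 = -1" "- s ! 1 = 1 \<or> - s ! 1 = -1"
    "- s ! 2 = 1 \<or> - s ! 2 = -1" "- s ! 3 = 1 \<or> - s ! 3 = -1"
    using sp(2-5) by auto
  have "clmul Q Q' = scal 16 clone"
    unfolding Q_def Q'_def by (rule four_rot1_inverse[OF ne U sp(2-5)])
  then have RS: "clmul (rotor m P s) S = clone"
    by (simp add: R S_def clmul_scal_left clmul_scal_right scal_scal)
  \<comment> \<open>\<open>Q'\<close> has the same shape as \<open>Q\<close>, with the pairs listed
    backwards and the signs negated, so the same lemma applies.\<close>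
  have "clmul Q' Q = scal 16 clone"
    using four_rot1_inverse[OF ne(4,3,2,1) U' sm(4,3,2,1)] unfolding Q_def Q'_def by simp
  then have SR: "clmul S (rotor m P s) = clone"
    by (simp add: R S_def clmul_scal_left clmul_scal_right scal_scal)
  have "Q' \<in> Cl15"
    unfolding Q'_def using U by (intro clmul_in_Cl15 rot1_in_Cl15) auto
  then have S: "S \<in> Cl15" unfolding S_def by (rule scal_in_Cl15)
  \<comment> \<open>The four pairs are respected or split together, so the first one decides for
    all.\<close>
  define \<tau> where "\<tau> T = (if m ! 0 \<in> T \<longleftrightarrow> m ! j0 \<in> T then T else sym_diff T (set m))" for T
  have \<tau>: "exchange (m ! 0) (m ! j0) (exchange (m ! i1) (m ! j1) (exchange (m ! i2) (m ! j2) (exchange (m ! i3) (m ! j3) T))) = \<tau> T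
      \<and> \<tau> T \<in> set PhiTerms" if T: "T \<in> set PhiTerms" for T
  proof (cases "m ! 0 \<in> T \<longleftrightarrow> m ! j0 \<in> T")
    case True
    then have "\<forall>(i, j)\<in>set P. m ! i \<in> T \<longleftrightarrow> m ! j \<in> T"
      using pairing_respects_or_splits m P T unfolding P' by fastforce
    then show ?thesis
      using T by (simp add: P' \<tau>_def exchange_same)
  next
    case False
    then have "\<forall>(i, j)\<in>set P. m ! i \<in> T \<longleftrightarrow> m ! j \<notin> T"
      using pairing_respects_or_splits m P T unfolding P' by fastforce
    then have "exchange (m ! 0) (m ! j0) (exchange (m ! i1) (m ! j1) (exchange (m ! i2) (m ! j2) (exchange (m ! i3) (m ! j3) T)))
        = sym_diff T (set m)"
      unfolding set_m[symmetric] by (intro four_exchange_split[OF dist]) (simp_all add: P')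
    \<comment> \<open>A split pair has one element in \<open>T\<close>, which excludes the disjoint
      case.\<close>
    moreover have "T \<inter> set m \<noteq> {}"
      using False unfolding set_m[symmetric] by blast
    then have "sym_diff T (set m) \<in> set PhiTerms"
      using PhiTerms_sym_diff_dual m T by blast
    ultimately show ?thesis
      using False by (simp add: \<tau>_def)
  qed
  \<comment> \<open>Adding \<open>set m\<close> toggles both \<open>m ! 0\<close> and
    \<open>m ! j0\<close>, so the condition in \<open>\<tau>\<close> is unchanged and
    \<open>\<tau>\<close> is an involution.\<close>
  have "m ! 0 \<in> set m" "m ! j0 \<in> set m" using set_m by blast+
  then have \<tau>\<tau>: "\<tau> (\<tau> T) = T" for T
    unfolding \<tau>_def by auto
  have "\<exists>c. (c = 1 \<or> c = -1) \<and> clmul (clmul (rotor m P s) (blade T)) S = scal c (blade (\<tau> T))"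
    if T: "T \<in> set PhiTerms" for T
  proof -
    obtain c where c: "c = 1 \<or> c = -1" "clmul (clmul Q (blade T)) Q' = scal (16 * c) (blade (\<tau> T))"
      using four_rot1_conj_blade[OF ne U PhiTerms_subset[OF T] sp(2-5)] \<tau>[OF T]
      unfolding Q_def Q'_def by auto
    then have "clmul (clmul (rotor m P s) (blade T)) S = scal c (blade (\<tau> T))"
      by (simp add: R S_def clmul_scal_left clmul_scal_right scal_scal)
    with c(1) show ?thesis by blast
  qed
  then obtain c where c: "\<And>T. T \<in> set PhiTerms \<Longrightarrow> c T = 1 \<or> c T = (-1::real)"
    "\<And>T. T \<in> set PhiTerms \<Longrightarrow> clmul (clmul (rotor m P s) (blade T)) S = scal (c T) (blade (\<tau> T))"
    by metis
  \<comment> \<open>The blade of term \<open>k\<close> arises from its preimage under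
    \<open>\<tau>\<close>, which is also its image.\<close>
  define \<eta> where "\<eta> k = c (\<tau> (PhiTerms ! k))" for k
  have "\<forall>k<15. \<eta> k = 1 \<or> \<eta> k = -1"
    using \<tau> c(1) unfolding \<eta>_def by (simp add: length_PhiTerms)
  moreover have "clmul (clmul (rotor m P s) Phi) S = (\<lambda>C. \<Sum>k<15. \<eta> k * blade (PhiTerms ! k) C)"
  proof
    fix C
    have "clmul (clmul (rotor m P s) Phi) S C
        = (\<Sum>T\<in>set PhiTerms. clmul (clmul (rotor m P s) (blade T)) S C)"
      unfolding Phi_def clmul_sum_left clmul_sum_right by (rule sum_PhiTerms_nth)
    also have "\<dots> = (\<Sum>T\<in>set PhiTerms. c T * blade (\<tau> T) C)"
      by (intro sum.cong) (simp_all add: c(2) scal_def)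
    also have "\<dots> = (\<Sum>T\<in>set PhiTerms. c (\<tau> T) * blade T C)"
      by (rule sum.reindex_bij_witness[where i = \<tau> and j = \<tau>]) (simp_all add: \<tau> \<tau>\<tau>)
    also have "\<dots> = (\<Sum>k<15. \<eta> k * blade (PhiTerms ! k) C)"
      unfolding \<eta>_def by (rule sum_PhiTerms_nth[symmetric])
    finally show "clmul (clmul (rotor m P s) Phi) S C = (\<Sum>k<15. \<eta> k * blade (PhiTerms ! k) C)" .
  qed
  ultimately show ?thesis using S RS SR by blast
qed

subsection \<open>Distinctness\<close>

lemma dual_list_eqI: "m \<in> set dual_lists \<Longrightarrow> m' \<in> set dual_lists \<Longrightarrow> set m = set m' \<Longrightarrow> m = m'"
  by (metis sorted_list_of_dual_list)

lemma Union_planes: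
  assumes "m \<in> set dual_lists" "P \<in> set pairings"
  shows "\<Union> (planes m P) = set m"
proof -
  note mp = dual_list_props[OF assms(1)]
  obtain j0 i1 j1 i2 j2 i3 j3 where P': "P = [(0, j0), (i1, j1), (i2, j2), (i3, j3)]"
    and set_m: "{m ! 0, m ! j0, m ! i1, m ! j1, m ! i2, m ! j2, m ! i3, m ! j3} = set m"
    using pairing_nth[OF assms(2) mp(2,3)] by metis
  show ?thesis unfolding planes_def set_m[symmetric] P' by auto
qed

text \<open>The union of the planes determines the term, and the plane through its least index
  determines the pairing.\<close>

lemma inj_on_planes: "inj_on (\<lambda>(m, P). planes m P) (set dual_lists \<times> set pairings)"
proof (intro inj_onI, clarsimp)
  fix m P m' P'
  assume m: "m \<in> set dual_lists" "m' \<in> set dual_lists" and P: "P \<in> set pairings" "P' \<in> set pairings"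
    and eq: "planes m P = planes m' P'"
  from eq have "set m = set m'" using Union_planes m P by metis
  then have [simp]: "m' = m" using dual_list_eqI m by blast
  note mp = dual_list_props[OF m(1)]
  obtain j where j: "P ! 0 = (0, j)" "P ! 0 \<in> set P" "j < 8"
    using pairing_nth[OF P(1) mp(2,3)] by (metis list.set_intros(1) nth_Cons_0)
  have "{m ! 0, m ! j} \<in> planes m P"
    using j unfolding planes_def by force
  then have "{m ! 0, m ! j} \<in> planes m P'" using eq by simp
  then obtain i k where ik: "(i, k) \<in> set P'" "{m ! 0, m ! j} = {m ! i, m ! k}"
    unfolding planes_def by auto
  \<comment> \<open>The order within a pair excludes the reversed match \<open>i = j\<close>,
    \<open>k = 0\<close>.\<close>
  have "i < k" using pairing_ordered[OF P(2) ik(1)] .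
  moreover have "i \<in> set (concat (map (\<lambda>(i, j). [i, j]) P'))" "k \<in> set (concat (map (\<lambda>(i, j). [i, j]) P'))"
    using ik(1) by force+
  then have "i < 8" "k < 8"
    using pairing_indices P(2) by (metis atLeastLessThan_iff)+
  ultimately have "(i, k) = (0, j)"
    using ik(2) j(3) mp by (auto simp: doubleton_eq_iff nth_eq_iff_index_eq)
  then have "P ! 0 \<in> set P'" using ik(1) j(1) by simp
  then show "m = m' \<and> P = P'" using pairing_eqI P by auto
qed

lemma rotor_coeff:
  assumes "m \<in> set dual_lists" "P \<in> set pairings" "s \<in> set sign_patterns"
  shows "i < 4 \<Longrightarrow> rotor m P s {m ! fst (P ! i), m ! snd (P ! i)} = s ! i / 4"
    and "rotor m P s C \<noteq> 0 \<Longrightarrow> C \<subseteq> set m"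
    and "rotor m P s C \<noteq> 0 \<Longrightarrow> m ! 0 \<in> C \<longleftrightarrow> m ! snd (P ! 0) \<in> C"
proof -
  note mp = dual_list_props[OF assms(1)]
  obtain j0 i1 j1 i2 j2 i3 j3 where P': "P = [(0, j0), (i1, j1), (i2, j2), (i3, j3)]"
    and dist: "distinct [m ! 0, m ! j0, m ! i1, m ! j1, m ! i2, m ! j2, m ! i3, m ! j3]"
    and set_m: "{m ! 0, m ! j0, m ! i1, m ! j1, m ! i2, m ! j2, m ! i3, m ! j3} = set m"
    using pairing_nth[OF assms(2) mp(2,3)] by metis
  have U: "{m ! 0, m ! j0, m ! i1, m ! j1, m ! i2, m ! j2, m ! i3, m ! j3} \<subseteq> {1..15}"
    using set_m mp(4) by simp
  note Q = four_rot1_coeff[OF dist U, of "s ! 0" "s ! 1" "s ! 2" "s ! 3"]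
  have R: "rotor m P s C = (1/4) * clmul (clmul (clmul (rot1 (m ! 0) (m ! j0) (s ! 0))
      (rot1 (m ! i1) (m ! j1) (s ! 1))) (rot1 (m ! i2) (m ! j2) (s ! 2))) (rot1 (m ! i3) (m ! j3) (s ! 3)) C" for C
    by (simp add: rotor_def P' scal_def)
  show "rotor m P s {m ! fst (P ! i), m ! snd (P ! i)} = s ! i / 4" if "i < 4"
  proof -
    consider "i = 0" | "i = 1" | "i = 2" | "i = 3" using \<open>i < 4\<close> by linarith
    then show ?thesis unfolding R by cases (use Q(1-4) in \<open>simp_all add: P'\<close>)
  qed
  show "rotor m P s C \<noteq> 0 \<Longrightarrow> C \<subseteq> set m"
    using Q(5)[of C] unfolding R set_m[symmetric] by simp
  show "rotor m P s C \<noteq> 0 \<Longrightarrow> m ! 0 \<in> C \<longleftrightarrow> m ! snd (P ! 0) \<in> C"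
    using Q(6)[of C] unfolding R by (simp add: P')
qed

lemma rotor_plane_nonzero:
  assumes "m \<in> set dual_lists" "P \<in> set pairings" "s \<in> set sign_patterns" "(i, j) \<in> set P"
  shows "rotor m P s {m ! i, m ! j} \<noteq> 0"
proof -
  have "length P = 4" using pairing_indices assms(2) by blast
  then obtain k where k: "k < 4" "P ! k = (i, j)"
    using assms(4) by (auto simp: in_set_conv_nth)
  have "s ! k \<noteq> 0"
  proof -
    consider "k = 0" | "k = 1" | "k = 2" | "k = 3" using k(1) by linarith
    then show ?thesis by cases (use sign_pattern_props[OF assms(3)] in auto)
  qed
  then show ?thesis using rotor_coeff(1)[OF assms(1-3) k(1)] k by simp
qed

text \<open>The four planes lie in the support and already cover \<open>set m\<close>.\<close>

lemma rotor_support: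
  assumes "m \<in> set dual_lists" "P \<in> set pairings" "s \<in> set sign_patterns"
  shows "\<Union> {C. rotor m P s C \<noteq> 0} = set m"
proof
  show "\<Union> {C. rotor m P s C \<noteq> 0} \<subseteq> set m"
    using rotor_coeff(2)[OF assms] by blast
  have "C \<in> planes m P \<Longrightarrow> rotor m P s C \<noteq> 0" for C
    using rotor_plane_nonzero[OF assms] unfolding planes_def by auto
  then show "set m \<subseteq> \<Union> {C. rotor m P s C \<noteq> 0}"
    unfolding Union_planes[OF assms(1,2), symmetric] by blast
qed

lemma inj_on_rotor:
  "inj_on (\<lambda>(m, P, s). rotor m P s) (set dual_lists \<times> set pairings \<times> set sign_patterns)"
proof (intro inj_onI, clarsimp)
  fix m P s m' P' s'
  assume m: "m \<in> set dual_lists" "m' \<in> set dual_lists" and P: "P \<in> set pairings" "P' \<in> set pairings"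
    and s: "s \<in> set sign_patterns" "s' \<in> set sign_patterns"
    and eq: "rotor m P s = rotor m' P' s'"
  from eq have "set m = set m'" using rotor_support m P s by metis
  then have [simp]: "m' = m" using dual_list_eqI m by blast
  note mp = dual_list_props[OF m(1)]
  obtain j where j: "P ! 0 = (0, j)" "P ! 0 \<in> set P" "j < 8"
    using pairing_nth[OF P(1) mp(2,3)] by (metis list.set_intros(1) nth_Cons_0)
  obtain j' where j': "P' ! 0 = (0, j')" "P' ! 0 \<in> set P'" "j' < 8"
    using pairing_nth[OF P(2) mp(2,3)] by (metis list.set_intros(1) nth_Cons_0)
  \<comment> \<open>The set \<open>{m ! 0, m ! j}\<close> lies in the support of the second rotor as
    well, so along with \<open>m ! 0\<close> it must contain the partner
    \<open>m ! j'\<close>.\<close>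
  have "rotor m P' s' {m ! 0, m ! j} \<noteq> 0"
    using rotor_plane_nonzero[OF m(1) P(1) s(1)] j eq by simp
  then have "m ! j' \<in> {m ! 0, m ! j}"
    using rotor_coeff(3)[OF m(1) P(2) s(2)] j'(1) by fastforce
  \<comment> \<open>This rules out \<open>m ! j' = m ! 0\<close>.\<close>
  moreover have "0 < j'" using pairing_ordered[OF P(2)] j' by metis
  ultimately have "j' = j"
    using j j' mp by (auto simp: nth_eq_iff_index_eq)
  then have [simp]: "P' = P" using pairing_eqI[OF P] j(1) j'(1,2) by simp
  have "s = s'"
  proof (rule nth_equalityI)
    show "length s = length s'" using sign_pattern_props s by metis
    fix i assume "i < length s"
    then have "i < 4" using sign_pattern_props(1)[OF s(1)] by simp
    then show "s ! i = s' ! i"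
      using rotor_coeff(1)[OF m(1) P(1) s(1)] rotor_coeff(1)[OF m(1) P(1) s(2)] eq by simp
  qed
  then show "m = m' \<and> P = P' \<and> s = s'" by simp
qed

theorem theorem3:
  shows "(\<forall>A. PhiStar A \<noteq> 0 \<longrightarrow> (\<forall>P\<in>set pairings. \<forall>s\<in>set sign_patterns.
            (\<exists>S\<in>Cl15. clmul (rotor (sorted_list_of_set A) P s) S = clone
                    \<and> clmul S (rotor (sorted_list_of_set A) P s) = clone
                    \<and> (\<exists>\<eta>::nat \<Rightarrow> real. (\<forall>k<15. \<eta> k = 1 \<or> \<eta> k = -1) \<and>
                         clmul (clmul (rotor (sorted_list_of_set A) P s) Phi) S
                           = (\<lambda>C. \<Sum>k<15. \<eta> k * blade (PhiTerms ! k) C)))))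
       \<and> card {planes (sorted_list_of_set A) P | A P. PhiStar A \<noteq> 0 \<and> P \<in> set pairings} = 105
       \<and> card {rotor (sorted_list_of_set A) P s | A P s.
                 PhiStar A \<noteq> 0 \<and> P \<in> set pairings \<and> s \<in> set sign_patterns} = 420"
proof (intro conjI allI impI ballI)
  fix A P s assume "PhiStar A \<noteq> 0" and Ps: "P \<in> set pairings" "s \<in> set sign_patterns"
  then obtain m where "m \<in> set dual_lists" "A = set m" by (auto simp: PhiStar_nonzero_iff)
  then show "\<exists>S\<in>Cl15. clmul (rotor (sorted_list_of_set A) P s) S = clone
      \<and> clmul S (rotor (sorted_list_of_set A) P s) = clone
      \<and> (\<exists>\<eta>::nat \<Rightarrow> real. (\<forall>k<15. \<eta> k = 1 \<or> \<eta> k = -1) \<and>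
           clmul (clmul (rotor (sorted_list_of_set A) P s) Phi) S
             = (\<lambda>C. \<Sum>k<15. \<eta> k * blade (PhiTerms ! k) C))"
    using rotor_conj_Phi[OF _ Ps] by (simp only: sorted_list_of_dual_list)
next
  \<comment> \<open>Terms correspond to their increasing lists, so the set is an injective image of
    a product of size 15 * 7.\<close>
  have "{planes (sorted_list_of_set A) P | A P. PhiStar A \<noteq> 0 \<and> P \<in> set pairings}
      = (\<lambda>(m, P). planes m P) ` (set dual_lists \<times> set pairings)"
    by (force simp: PhiStar_nonzero_iff sorted_list_of_dual_list)
  then show "card {planes (sorted_list_of_set A) P | A P. PhiStar A \<noteq> 0 \<and> P \<in> set pairings} = 105"
    by (simp add: card_image inj_on_planes card_cartesian_product card_dual_lists card_pairings)
next
  \<comment> \<open>Likewise with the sign patterns as a third factor: 15 * 7 * 4.\<close>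
  have "{rotor (sorted_list_of_set A) P s | A P s.
        PhiStar A \<noteq> 0 \<and> P \<in> set pairings \<and> s \<in> set sign_patterns}
      = (\<lambda>(m, P, s). rotor m P s) ` (set dual_lists \<times> set pairings \<times> set sign_patterns)"
    by (force simp: PhiStar_nonzero_iff sorted_list_of_dual_list)
  then show "card {rotor (sorted_list_of_set A) P s | A P s.
        PhiStar A \<noteq> 0 \<and> P \<in> set pairings \<and> s \<in> set sign_patterns} = 420"
    by (simp add: card_image inj_on_rotor card_cartesian_product card_dual_lists card_pairings
        card_sign_patterns)
qed

end
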